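(* For every $n\ge 0$, $$D_n(x)-T_n(x)=D^+_{n+1}(x)-T^+_{n+1}(x)=\frac{1}{x}\left(T^-_{n+2}(x)-D^-_{n+2}(x)\right)=x^{\frac{n+1}{2}}U_{n+1}\left(\frac{1}{2\sqrt{x}}\right),$$ where $U_m$ denotes the $m$-th Chebyshev polynomial of the second kind.
   Context: Let $[n]=\{1,\dots,n\}$ and let $B_n$ be the group of signed permutations: permutations $\pi$ of $\{\pm1,\dots,\pm n\}$ with $\pi(-i)=-\pi(i)$. Each $\pi\in B_n$ is identified with the word $\pi(0)\pi(1)\cdots\pi(n)$, where $\pi(0)=0$. A double descent of $\pi\in B_n$ is an index $i\in[n-1]$ with $\pi(i-1)>\pi(i)>\pi(i+1)$ (so $i=1$ uses $\pi(0)=0$). A permutation $\pi\in B_n$ is a signed simsun permutation if for every $0\le k\le n$, the word obtained from $\pi$ by removing the $k$ entries $\pm n,\pm(n-1),\dots,\pm(n-k+1)$ (keeping the leading $0$ and the order of the remaining entries) is a signed permutation in $B_{n-k}$ with no double descents. Let $\mathcal{RB}_n$ be the set of signed simsun permutations in $B_n$. Let $\mathcal{RD}_n$ (resp. $\mathcal{RT}_n$) be the set of $\pi\in\mathcal{RB}_n$ such that $\{\pi(1),\dots,\pi(n)\}$ contains an even (resp. odd) number of negative terms. For a superscript $+$ (resp. $-$), $\mathcal{RD}_n^{\pm},\mathcal{RT}_n^{\pm}$ denote the subsets of those $\pi$ with $\pi(1)>0$ (resp. $\pi(1)<0$). The type $B$ descent number is $\mathrm{des}_B(\pi)=|\{i\in\{0,1,\dots,n-1\}:\pi(i)>\pi(i+1)\}|$.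 Define, for $n\ge 1$, $D_n(x)=\sum_{\pi\in\mathcal{RD}_n}x^{\mathrm{des}_B(\pi)}$, $T_n(x)=\sum_{\pi\in\mathcal{RT}_n}x^{\mathrm{des}_B(\pi)}$, $D_n^{\pm}(x)=\sum_{\pi\in\mathcal{RD}_n^{\pm}}x^{\mathrm{des}_B(\pi)}$, $T_n^{\pm}(x)=\sum_{\pi\in\mathcal{RT}_n^{\pm}}x^{\mathrm{des}_B(\pi)}$; by convention $D_0(x)=D_0^+(x)=1$ and $D_0^-(x)=T_0(x)=T_0^+(x)=T_0^-(x)=0$. The Chebyshev polynomials of the second kind are given by $U_0(x)=1$, $U_1(x)=2x$, $U_{m+1}(x)=2xU_m(x)-U_{m-1}(x)$ for $m\ge1$. The expression with $\sqrt{x}$ may be read for real $x>0$; it is a polynomial in $x$. *)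

theory Defs
  imports
    Complex_Main
    "HOL-Combinatorics.Permutations"
    "HOL-Computational_Algebra.Polynomial"
begin

text \<open>
  A signed permutation is a function on all integers that fixes everything outside
  \<open>{\<plusminus>1,\<dots>,\<plusminus>n}\<close>; in particular \<open>\<pi> 0 = 0\<close>, as the word convention requires.
\<close>

definition signed_perms :: "nat \<Rightarrow> (int \<Rightarrow> int) set" where
  "signed_perms n = {\<pi>. \<pi> permutes ({- int n..int n} - {0}) \<and> (\<forall>i. \<pi> (- i) = - \<pi> i)}"

definition sp_word :: "nat \<Rightarrow> (int \<Rightarrow> int) \<Rightarrow> int list" where
  "sp_word n \<pi> = map \<pi> [0..int n]"

definition double_descent :: "nat \<Rightarrow> (int \<Rightarrow> int) \<Rightarrow> int \<Rightarrow> bool" where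
  "double_descent n \<pi> i \<longleftrightarrow> i \<in> {1..int n - 1} \<and> \<pi> (i - 1) > \<pi> i \<and> \<pi> i > \<pi> (i + 1)"

definition remove_largest :: "nat \<Rightarrow> nat \<Rightarrow> int list \<Rightarrow> int list" where
  "remove_largest n k w = filter (\<lambda>v. \<bar>v\<bar> \<notin> {int n - int k + 1..int n}) w"

definition signed_simsun :: "nat \<Rightarrow> (int \<Rightarrow> int) \<Rightarrow> bool" where
  "signed_simsun n \<pi> \<longleftrightarrow> \<pi> \<in> signed_perms n \<and>
     (\<forall>k\<le>n. \<exists>\<sigma>\<in>signed_perms (n - k).
        sp_word (n - k) \<sigma> = remove_largest n k (sp_word n \<pi>) \<and>
        (\<forall>i. \<not> double_descent (n - k) \<sigma> i))"

definition RB :: "nat \<Rightarrow> (int \<Rightarrow> int) set" where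
  "RB n = {\<pi>. signed_simsun n \<pi>}"

definition neg_count :: "nat \<Rightarrow> (int \<Rightarrow> int) \<Rightarrow> nat" where
  "neg_count n \<pi> = card {v \<in> \<pi> ` {1..int n}. v < 0}"

definition RD :: "nat \<Rightarrow> (int \<Rightarrow> int) set" where
  "RD n = {\<pi> \<in> RB n. even (neg_count n \<pi>)}"

definition RT :: "nat \<Rightarrow> (int \<Rightarrow> int) set" where
  "RT n = {\<pi> \<in> RB n. odd (neg_count n \<pi>)}"

definition RD_plus :: "nat \<Rightarrow> (int \<Rightarrow> int) set" where
  "RD_plus n = {\<pi> \<in> RD n. \<pi> 1 > 0}"

definition RD_minus :: "nat \<Rightarrow> (int \<Rightarrow> int) set" where
  "RD_minus n = {\<pi> \<in> RD n. \<pi> 1 < 0}"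

definition RT_plus :: "nat \<Rightarrow> (int \<Rightarrow> int) set" where
  "RT_plus n = {\<pi> \<in> RT n. \<pi> 1 > 0}"

definition RT_minus :: "nat \<Rightarrow> (int \<Rightarrow> int) set" where
  "RT_minus n = {\<pi> \<in> RT n. \<pi> 1 < 0}"

definition des_B :: "nat \<Rightarrow> (int \<Rightarrow> int) \<Rightarrow> nat" where
  "des_B n \<pi> = card {i \<in> {0..int n - 1}. \<pi> i > \<pi> (i + 1)}"

definition des_poly :: "nat \<Rightarrow> (int \<Rightarrow> int) set \<Rightarrow> real poly" where
  "des_poly n A = (\<Sum>\<pi>\<in>A. monom 1 (des_B n \<pi>))"

text \<open>The values at \<open>n = 0\<close> are set by convention.\<close>

definition D_poly :: "nat \<Rightarrow> real poly" where
  "D_poly n = (if n = 0 then 1 else des_poly n (RD n))"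

definition T_poly :: "nat \<Rightarrow> real poly" where
  "T_poly n = (if n = 0 then 0 else des_poly n (RT n))"

definition D_plus_poly :: "nat \<Rightarrow> real poly" where
  "D_plus_poly n = (if n = 0 then 1 else des_poly n (RD_plus n))"

definition D_minus_poly :: "nat \<Rightarrow> real poly" where
  "D_minus_poly n = (if n = 0 then 0 else des_poly n (RD_minus n))"

definition T_plus_poly :: "nat \<Rightarrow> real poly" where
  "T_plus_poly n = (if n = 0 then 0 else des_poly n (RT_plus n))"

definition T_minus_poly :: "nat \<Rightarrow> real poly" where
  "T_minus_poly n = (if n = 0 then 0 else des_poly n (RT_minus n))"

fun Chebyshev_U :: "nat \<Rightarrow> real poly" where
  "Chebyshev_U 0 = 1"
| "Chebyshev_U (Suc 0) = [:0, 2:]"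
| "Chebyshev_U (Suc (Suc m)) = [:0, 2:] * Chebyshev_U (Suc m) - Chebyshev_U m"

end

theory Submission
  imports Defs
begin

text \<open>
  Deleting the letter \<open>\<plusminus>(n + 1)\<close> turns a signed simsun permutation of size \<open>n + 1\<close> into one of
  size \<open>n\<close>, so every simsun word of size \<open>n + 1\<close> arises exactly once by inserting \<open>n + 1\<close> or
  \<open>-(n + 1)\<close> after some letter of a simsun word \<open>w\<close> of size \<open>n\<close>, subject only to the
  requirement that the result has no double descent. Weight each word by the sign given by the
  parity of its negative letters times \<open>x\<close> to the number of descents. An inserted letter has
  larger absolute value than all others, so it is a peak or a valley or ends the word, and whether
  it is allowed depends only on the neighbouring steps: the positive letter may enter an ascent unless a
  descent follows, the negative one may enter an ascent unless a descent precedes. The two signs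
  therefore cancel almost completely. With \<open>d\<close> the number of descents of \<open>w\<close>, what survives is
  \<open>x\<^sup>d\<close> if \<open>w\<close> starts with a descent and \<open>x\<^sup>d - x * x\<^sup>d\<close> otherwise
  (lemma \<open>signed_insertions\<close>). If only results that do not start with a descent are counted, what
  survives is always \<open>x\<^sup>d\<close> (lemma \<open>signed_insertions_ascent\<close>).

  Let \<open>S n\<close> be the signed sum over all simsun words of size \<open>n\<close>, and \<open>P n\<close> the one over those
  that do not start with a descent; these are \<open>D - T\<close> and \<open>D\<^sup>+ - T\<^sup>+\<close>. The two
  local counts give \<open>P (n + 1) = S n\<close> and \<open>S (n + 1) = S n - x * P n\<close>. The first is the
  first claimed equality. Together they give \<open>T\<^sup>- - D\<^sup>- = P - S = x * P (n + 1)\<close> at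
  size \<open>n + 2\<close>, which is the second, and \<open>P (n + 2) = P (n + 1) - x * P n\<close> with
  \<open>P 0 = P 1 = 1\<close>. For \<open>x = s\<^sup>2\<close> the numbers \<open>s\<^sup>n U\<^sub>n(1 / (2 s))\<close> obey the same
  recurrence with the same initial values, which is the third.
\<close>

section \<open>Descents of words and insertion of a letter\<close>

fun des :: "int list \<Rightarrow> nat" where
  "des (a # b # u) = (if b < a then 1 else 0) + des (b # u)"
| "des _ = 0"

fun no_dd :: "int list \<Rightarrow> bool" where
  "no_dd (a # b # c # u) \<longleftrightarrow> \<not> (b < a \<and> c < b) \<and> no_dd (b # c # u)"
| "no_dd _ \<longleftrightarrow> True"

fun first_descent :: "int list \<Rightarrow> bool" where
  "first_descent (a # b # u) \<longleftrightarrow> b < a"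
| "first_descent _ \<longleftrightarrow> False"

fun inserts :: "int \<Rightarrow> int list \<Rightarrow> int list list" where
  "inserts v [] = []"
| "inserts v (a # u) = (a # v # u) # map ((#) a) (inserts v u)"

text \<open>
  The base ring is arbitrary, so that the same recurrences hold for descent polynomials and for
  their values at a real number.
\<close>

definition insertion_sum :: "'a::comm_ring_1 \<Rightarrow> int \<Rightarrow> int list \<Rightarrow> 'a" where
  "insertion_sum x v w = (\<Sum>w'\<leftarrow>inserts v w. if no_dd w' then x ^ des w' else 0)"

definition insertion_sum_asc :: "'a::comm_ring_1 \<Rightarrow> int \<Rightarrow> int list \<Rightarrow> 'a" where
  "insertion_sum_asc x v w =
     (\<Sum>w'\<leftarrow>inserts v w. if no_dd w' \<and> \<not> first_descent w' then x ^ des w' else 0)"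

lemma no_dd_Cons: "no_dd (a # w) \<longleftrightarrow> no_dd w \<and> \<not> (first_descent (a # w) \<and> first_descent w)"
  by (cases w rule: no_dd.cases) auto

lemma des_Cons: "des (a # w) = (if first_descent (a # w) then 1 else 0) + des w"
  by (cases w) auto

text \<open>
  Insertions other than the one right after \<open>a\<close> leave the first step \<open>a < b\<close> in place, and a
  leading ascent affects neither the descent number nor the double descents.
\<close>

lemma insertion_sum_Cons_ascent:
  assumes "a < b"
  shows "insertion_sum x v (a # b # u) =
    (if no_dd (a # v # b # u) then x ^ des (a # v # b # u) else 0) + insertion_sum x v (b # u)"
proof -
  have "map ((\<lambda>w'. if no_dd w' then x ^ des w' else 0) \<circ> (#) a) (inserts v (b # u))
      = map (\<lambda>w'. if no_dd w' then x ^ des w' else 0) (inserts v (b # u))"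
    using assms by (intro map_cong refl) (auto simp: no_dd_Cons[of a] des_Cons[of a])
  then show ?thesis
    unfolding insertion_sum_def inserts.simps(2)[of v a] by (simp only: list.map map_map sum_list.Cons)
qed

text \<open>
  A leading descent contributes a factor \<open>x\<close> to every later insertion, and it forbids those
  that put a smaller letter right after \<open>b\<close>; the subtracted term removes exactly these.
\<close>

lemma insertion_sum_Cons_descent:
  assumes "b < a" "\<not> first_descent (b # u)" "distinct (b # u)"
  shows "insertion_sum x v (a # b # u) =
    (if no_dd (a # v # b # u) then x ^ des (a # v # b # u) else 0)
    + x * (insertion_sum x v (b # u)
        - (if v < b \<and> no_dd (b # v # u) then x ^ des (b # v # u) else 0))"
proof -
  let ?f = "\<lambda>w'. if no_dd w' then x ^ des w' else 0"
  have nfd: "\<not> first_descent (b # w')" if "w' \<in> set (inserts v u)" for w'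
    using that assms(2) by (cases u) auto
  have tail: "(\<Sum>w'\<leftarrow>inserts v u. ?f (a # b # w')) = x * (\<Sum>w'\<leftarrow>inserts v u. ?f (b # w'))"
    unfolding sum_list_const_mult[symmetric] using assms nfd
    by (intro arg_cong[where f = sum_list] map_cong refl) (auto simp: no_dd_Cons[of a] des_Cons[of a])
  show ?thesis
    using assms tail unfolding insertion_sum_def
    by (auto simp: o_assoc o_def no_dd_Cons[of a] des_Cons[of a] algebra_simps)
qed

text \<open>
  The induction removes letters from the front. Right after \<open>a\<close>, the letters \<open>m\<close> and \<open>- m\<close>
  contribute the same power of \<open>x\<close>, so they cancel unless \<open>m\<close> is forbidden there, which happens
  when \<open>a < b\<close> is followed by a descent; this failure supplies the term that the induction
  hypothesis for \<open>b # u\<close> lacks.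
  If \<open>b < a\<close>, the step after \<open>b\<close> is not a descent, and the term forbidden by the leading
  descent (\<open>- m\<close> right after \<open>b\<close>) is precisely the negative term of the induction hypothesis.
  The base case is a one-letter word, after which \<open>m\<close> gives \<open>1\<close> and \<open>- m\<close> gives \<open>x\<close>.
\<close>

lemma signed_insertions:
  fixes x :: "'a::comm_ring_1"
  assumes "w \<noteq> []" "no_dd w" "distinct w" "\<forall>a\<in>set w. \<bar>a\<bar> < m"
  shows "insertion_sum x m w - insertion_sum x (- m) w =
    x ^ des w - (if first_descent w then 0 else x ^ Suc (des w))"
  using assms
proof (induction w rule: des.induct)
  case (1 a b u)
  then have ab: "a < m" "- m < a" "b < m" "- m < b" "a \<noteq> b" "distinct (b # u)"
    and IH: "insertion_sum x m (b # u) - insertion_sum x (- m) (b # u) =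
      x ^ des (b # u) - (if first_descent (b # u) then 0 else x ^ Suc (des (b # u)))"
    by (auto simp: no_dd_Cons abs_less_iff)
  show ?case
  proof (cases "a < b")
    case True
    show ?thesis
      unfolding insertion_sum_Cons_ascent[OF True] add_diff_add IH
      using ab True "1.prems"
      by (auto simp: no_dd_Cons des_Cons[of a] des_Cons[of m] des_Cons[of "-m"])
  next
    case False
    then have ba: "b < a" using ab by simp
    then have nfd: "\<not> first_descent (b # u)" using "1.prems"(2) by (auto simp: no_dd_Cons)
    have u: "\<not> first_descent ((- m) # u)"
      using "1.prems"(4) by (cases u) auto
    have IH': "insertion_sum x m (b # u) =
        insertion_sum x (- m) (b # u) + x ^ des (b # u) - x ^ Suc (des (b # u))"
      using IH nfd by (simp add: algebra_simps)
    show ?thesis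
      unfolding insertion_sum_Cons_descent[OF ba nfd ab(6)] IH'
      using ab ba nfd u "1.prems"
      by (auto simp: no_dd_Cons des_Cons[of a] des_Cons[of m] des_Cons[of "-m"] des_Cons[of b]
          algebra_simps)
  qed
qed (auto simp: insertion_sum_def abs_less_iff)

text \<open>
  Only an insertion right after the first letter can change the kind of the first step. If \<open>w\<close>
  starts with a descent, placing \<open>m\<close> there is the only way to remove it, without changing the
  number of descents. Otherwise the only insertion to discard is \<open>- m\<close> at that place, and it
  carries the negative term in \<open>signed_insertions\<close>.
\<close>

lemma signed_insertions_ascent:
  fixes x :: "'a::comm_ring_1"
  assumes "w \<noteq> []" "no_dd w" "distinct w" "\<forall>a\<in>set w. \<bar>a\<bar> < m"
  shows "insertion_sum_asc x m w - insertion_sum_asc x (- m) w = x ^ des w"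
proof -
  obtain a u where w: "w = a # u" using assms(1) by (cases w) auto
  have am: "a < m" "- m < a" using assms(4) w by (auto simp: abs_less_iff)
  \<comment> \<open>No letter lies below \<open>- m\<close>.\<close>
  have u: "\<not> first_descent ((- m) # u)"
    using assms(4) w by (cases u) auto
  have fd: "first_descent (a # w') \<longleftrightarrow> first_descent w" if "w' \<in> set (inserts v u)" for v w'
    using that w by (cases u) auto
  let ?f = "\<lambda>w'. if no_dd w' \<and> \<not> first_descent w' then x ^ des w' else 0"
  show ?thesis
  proof (cases "first_descent w")
    case True
    then have "map (?f \<circ> (#) a) (inserts v u) = map (\<lambda>_. 0) (inserts v u)" for v
      using fd by (intro map_cong refl) auto
    then have zero: "sum_list (map (?f \<circ> (#) a) (inserts v u)) = 0" for v
      by (simp only: sum_list_0)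
    have "first_descent (m # u)" "\<not> first_descent u"
      using True assms(2,4) by (cases u; auto simp: w no_dd_Cons abs_less_iff)+
    then show ?thesis
      unfolding insertion_sum_asc_def w inserts.simps(2)[of _ a] list.map map_map sum_list.Cons zero
      using True am assms(2) by (auto simp: w no_dd_Cons des_Cons[of m] des_Cons[of a])
  next
    case False
    then have eq: "map (?f \<circ> (#) a) (inserts v u) =
        map ((\<lambda>w'. if no_dd w' then x ^ des w' else 0) \<circ> (#) a) (inserts v u)" for v
      using fd by (intro map_cong refl) auto
    have "insertion_sum_asc x m w = insertion_sum x m w"
      unfolding insertion_sum_asc_def insertion_sum_def w inserts.simps(2)
        list.map map_map sum_list.Cons eq
      using am by auto
    moreover have "insertion_sum x (- m) w = insertion_sum_asc x (- m) w + x ^ Suc (des w)"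
      unfolding insertion_sum_asc_def insertion_sum_def w inserts.simps(2)
        list.map map_map sum_list.Cons eq
      using am False u assms(2) by (auto simp: w no_dd_Cons des_Cons[of "-m"] des_Cons[of a])
    ultimately show ?thesis
      using signed_insertions[OF assms, of x] False by (simp add: algebra_simps)
  qed
qed

section \<open>Simsun words\<close>

text \<open>
  The words keep the leading \<open>0\<close>, so that descents and double descents at the first position
  need no special treatment, and insertion after a letter never displaces it.
\<close>

definition signed_words :: "nat \<Rightarrow> int list set" where
  "signed_words n = {w. hd w = 0 \<and> distinct (map abs w) \<and> abs ` set w = {0..int n}}"

fun simsun_words :: "nat \<Rightarrow> int list list" where
  "simsun_words 0 = [[0]]"
| "simsun_words (Suc n) =
     filter no_dd (concat (map (\<lambda>w. inserts (int n + 1) w @ inserts (- (int n + 1)) w)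
       (simsun_words n)))"

lemma mem_inserts_iff:
  "w' \<in> set (inserts v w) \<longleftrightarrow> (\<exists>p q. w = p @ q \<and> p \<noteq> [] \<and> w' = p @ v # q)"
proof (induction w arbitrary: w')
  case (Cons a u)
  show ?case
  proof
    assume "w' \<in> set (inserts v (a # u))"
    then consider "w' = a # v # u" | u' where "u' \<in> set (inserts v u)" "w' = a # u'" by auto
    then show "\<exists>p q. a # u = p @ q \<and> p \<noteq> [] \<and> w' = p @ v # q"
    proof cases
      case 1 then show ?thesis by (intro exI[of _ "[a]"] exI[of _ u]) auto
    next
      case 2
      then obtain p q where "u = p @ q" "u' = p @ v # q" using Cons.IH by blast
      then show ?thesis using 2 by (intro exI[of _ "a # p"] exI[of _ q]) auto
    qed
  next
    assume "\<exists>p q. a # u = p @ q \<and> p \<noteq> [] \<and> w' = p @ v # q"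
    then obtain p q where pq: "a # u = p @ q" "p \<noteq> []" "w' = p @ v # q" by blast
    then obtain p' where p': "p = a # p'" "u = p' @ q" by (cases p) auto
    show "w' \<in> set (inserts v (a # u))"
    proof (cases "p' = []")
      case False
      then have "p' @ v # q \<in> set (inserts v u)" using Cons.IH p'(2) by blast
      then show ?thesis using pq p'(1) by simp
    qed (use pq p'(1) in simp)
  qed
qed auto

lemma distinct_inserts: "v \<notin> set w \<Longrightarrow> distinct (inserts v w)"
proof (induction w)
  case (Cons a u)
  have "v # u \<notin> set (inserts v u)" using Cons.prems by (cases u) auto
  then show ?case using Cons by (auto simp: distinct_map inj_on_def)
qed simp

lemma signed_words_nonempty: "w \<in> signed_words n \<Longrightarrow> w \<noteq> []"
  by (auto simp: signed_words_def)

lemma signed_words_bound: "w \<in> signed_words n \<Longrightarrow> a \<in> set w \<Longrightarrow> \<bar>a\<bar> \<le> int n"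
  unfolding signed_words_def by (metis (mono_tags, lifting) atLeastAtMost_iff image_eqI mem_Collect_eq)

lemma length_signed_words: "w \<in> signed_words n \<Longrightarrow> length w = Suc n"
  unfolding signed_words_def using distinct_card[of "map abs w"] by auto

lemma distinct_signed_words: "w \<in> signed_words n \<Longrightarrow> distinct w"
  by (simp add: signed_words_def distinct_map)

lemma filter_mem_signed_words:
  assumes w: "w \<in> signed_words n" and "j \<le> n"
  shows "filter (\<lambda>v. \<bar>v\<bar> \<le> int j) w \<in> signed_words j"
proof -
  obtain u where u: "w = 0 # u"
    using w signed_words_nonempty[OF w] by (cases w) (auto simp: signed_words_def)
  have "abs ` set (filter (\<lambda>v. \<bar>v\<bar> \<le> int j) w) = {a \<in> abs ` set w. a \<le> int j}"
    by auto
  also have "\<dots> = {0..int j}" using w \<open>j \<le> n\<close> by (auto simp: signed_words_def)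
  finally show ?thesis
    using w u by (auto simp: signed_words_def distinct_map intro: inj_on_subset)
qed

lemma filter_inserts:
  assumes "w' \<in> set (inserts v w)" "\<forall>a\<in>set w. P a" "\<not> P v"
  shows "filter P w' = w"
  using assms by (auto simp: mem_inserts_iff)

text \<open>Each word has a unique letter of absolute value \<open>n + 1\<close>, and it is not the leading \<open>0\<close>.\<close>

lemma signed_words_Suc:
  "w' \<in> signed_words (Suc n) \<longleftrightarrow>
    (\<exists>w\<in>signed_words n. \<exists>v\<in>{int n + 1, - (int n + 1)}. w' \<in> set (inserts v w))"
proof
  assume w': "w' \<in> signed_words (Suc n)"
  then have "int (Suc n) \<in> abs ` set w'" by (simp add: signed_words_def)
  then obtain v where v: "v \<in> set w'" "\<bar>v\<bar> = int n + 1" by auto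
  then obtain p q where pq: "w' = p @ v # q" by (meson split_list)
  have p: "p \<noteq> []" using w' v pq by (cases p) (auto simp: signed_words_def)
  have "\<bar>a\<bar> \<le> int n" if "a \<in> set (p @ q)" for a
  proof -
    have "\<bar>v\<bar> \<notin> abs ` set (p @ q)"
      using w' unfolding pq signed_words_def by auto
    then have "\<bar>a\<bar> \<noteq> \<bar>v\<bar>" using that by (metis imageI)
    moreover have "\<bar>a\<bar> \<le> int (Suc n)" using signed_words_bound[OF w'] that pq by auto
    ultimately show ?thesis using v by auto
  qed
  then have "filter (\<lambda>v. \<bar>v\<bar> \<le> int n) w' = p @ q"
    using pq v by (auto simp: filter_id_conv)
  then have "p @ q \<in> signed_words n"
    using filter_mem_signed_words[OF w', of n] by simp
  moreover have "v \<in> {int n + 1, - (int n + 1)}" using v by auto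
  ultimately show "\<exists>w\<in>signed_words n. \<exists>v\<in>{int n + 1, - (int n + 1)}. w' \<in> set (inserts v w)"
    using p pq mem_inserts_iff by metis
next
  assume "\<exists>w\<in>signed_words n. \<exists>v\<in>{int n + 1, - (int n + 1)}. w' \<in> set (inserts v w)"
  then obtain w v where w: "w \<in> signed_words n" and "v \<in> {int n + 1, - (int n + 1)}"
    and "w' \<in> set (inserts v w)"
    by blast
  then obtain p q where v: "\<bar>v\<bar> = int n + 1" and pq: "w = p @ q" "p \<noteq> []" "w' = p @ v # q"
    by (auto simp: mem_inserts_iff)
  have "abs ` set w' = insert (int n + 1) (abs ` set w)" using pq v by auto
  also have "\<dots> = {0..int (Suc n)}" using w by (auto simp: signed_words_def)
  finally have "abs ` set w' = {0..int (Suc n)}" .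
  moreover have "\<bar>v\<bar> \<notin> abs ` set w" using w v by (simp add: signed_words_def)
  ultimately show "w' \<in> signed_words (Suc n)"
    using w pq by (auto simp: signed_words_def)
qed

text \<open>
  The inductive generation agrees with the definition through iterated deletion: the largest
  letter disappears from all restrictions but the full word, so the conditions on \<open>w'\<close> are
  those on \<open>w\<close> together with \<open>no_dd w'\<close>.
\<close>

lemma set_simsun_words:
  "set (simsun_words n) =
    {w \<in> signed_words n. \<forall>j\<le>n. no_dd (filter (\<lambda>v. \<bar>v\<bar> \<le> int j) w)}"
proof (induction n)
  case 0
  have "w = [0]" if "w \<in> signed_words 0" for w
    using that length_signed_words[OF that] by (cases w) (auto simp: signed_words_def)
  moreover have "[0] \<in> signed_words 0" by (auto simp: signed_words_def)
  ultimately have words_0: "signed_words 0 = {[0]}" by blast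
  show ?case unfolding words_0 by (simp add: Collect_conv_if)
next
  case (Suc n)
  have key: "(\<forall>j\<le>Suc n. no_dd (filter (\<lambda>v. \<bar>v\<bar> \<le> int j) w')) \<longleftrightarrow>
      no_dd w' \<and> (\<forall>j\<le>n. no_dd (filter (\<lambda>v. \<bar>v\<bar> \<le> int j) w))"
    if "w \<in> signed_words n" "v \<in> {int n + 1, - (int n + 1)}" "w' \<in> set (inserts v w)" for w v w'
  proof -
    have "w' \<in> signed_words (Suc n)" using that signed_words_Suc by blast
    then have "filter (\<lambda>v. \<bar>v\<bar> \<le> int (Suc n)) w' = w'"
      using signed_words_bound unfolding filter_id_conv by blast
    moreover have "filter (\<lambda>v. \<bar>v\<bar> \<le> int j) w' = filter (\<lambda>v. \<bar>v\<bar> \<le> int j) w" if "j \<le> n" for j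
    proof -
      obtain p q where pq: "w = p @ q" "w' = p @ v # q" using \<open>w' \<in> set _\<close> mem_inserts_iff by metis
      have "\<not> \<bar>v\<bar> \<le> int j" using \<open>v \<in> _\<close> \<open>j \<le> n\<close> by auto
      then show ?thesis using pq by simp
    qed
    ultimately show ?thesis by (metis le_Suc_eq order_refl)
  qed
  show ?case
  proof (intro set_eqI)
    fix w'
    have "w' \<in> set (simsun_words (Suc n)) \<longleftrightarrow>
       no_dd w' \<and> (\<exists>w\<in>set (simsun_words n). \<exists>v\<in>{int n + 1, - (int n + 1)}. w' \<in> set (inserts v w))"
      by auto
    also have "\<dots> \<longleftrightarrow> w' \<in> {w \<in> signed_words (Suc n).
        \<forall>j\<le>Suc n. no_dd (filter (\<lambda>v. \<bar>v\<bar> \<le> int j) w)}"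
      unfolding Suc.IH mem_Collect_eq signed_words_Suc using key by blast
    finally show "w' \<in> set (simsun_words (Suc n)) \<longleftrightarrow> w' \<in> {w \<in> signed_words (Suc n).
        \<forall>j\<le>Suc n. no_dd (filter (\<lambda>v. \<bar>v\<bar> \<le> int j) w)}" .
  qed
qed

lemma simsun_words_signed: "w \<in> set (simsun_words n) \<Longrightarrow> w \<in> signed_words n"
  by (simp add: set_simsun_words)

lemma simsun_words_no_dd:
  assumes "w \<in> set (simsun_words n)" shows "no_dd w"
proof -
  have "filter (\<lambda>v. \<bar>v\<bar> \<le> int n) w = w"
    using signed_words_bound[OF simsun_words_signed[OF assms]] by (auto simp: filter_id_conv)
  then show ?thesis using assms by (force simp: set_simsun_words)
qed

text \<open>
  Deleting the largest letter recovers \<open>w\<close> from any word generated from it, so different words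
  have disjoint sets of extensions. This lets sums over the list stand for sums over the set.
\<close>

lemma distinct_simsun_words: "distinct (simsun_words n)"
proof (induction n)
  case (Suc n)
  let ?m = "int n + 1"
  let ?f = "\<lambda>w. inserts ?m w @ inserts (- ?m) w"
  have bd: "\<forall>a\<in>set w. \<bar>a\<bar> \<le> int n" if "w \<in> set (simsun_words n)" for w
    using signed_words_bound[OF simsun_words_signed[OF that]] by blast
  have filt: "filter (\<lambda>v. \<bar>v\<bar> \<le> int n) w' = w"
    if "w \<in> set (simsun_words n)" "w' \<in> set (?f w)" for w w'
  proof -
    from that(2) obtain v where "v \<in> {?m, - ?m}" "w' \<in> set (inserts v w)" by auto
    then show ?thesis using filter_inserts[OF _ bd[OF that(1)]] by auto
  qed
  have ne: "?f w \<noteq> []" if "w \<in> set (simsun_words n)" for w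
    using signed_words_nonempty[OF simsun_words_signed[OF that]] by (cases w) auto
  have disj: "set (?f w) \<inter> set (?f w2) = {}"
    if "w \<in> set (simsun_words n)" "w2 \<in> set (simsun_words n)" "w \<noteq> w2" for w w2
    using filt that by blast
  have "inj_on ?f (set (simsun_words n))"
  proof (rule inj_onI, rule ccontr)
    fix w w2 assume h: "w \<in> set (simsun_words n)" "w2 \<in> set (simsun_words n)" "?f w = ?f w2" "w \<noteq> w2"
    then have "set (?f w) = {}" using disj[OF h(1,2,4)] by (metis Int_absorb)
    then show False using ne[OF h(1)] by simp
  qed
  then have d1: "distinct (map ?f (simsun_words n))"
    using Suc.IH by (simp add: distinct_map)
  have d2: "distinct (?f w)" if w: "w \<in> set (simsun_words n)" for w
  proof -
    have v: "?m \<notin> set w" "- ?m \<notin> set w" using bd[OF w] by force+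
    have "set (inserts ?m w) \<inter> set (inserts (- ?m) w) = {}"
    proof (rule ccontr)
      assume "\<not> ?thesis"
      then obtain w' where w': "w' \<in> set (inserts ?m w)" "w' \<in> set (inserts (- ?m) w)" by auto
      have "?m \<in> set w'" using w'(1) by (auto simp: mem_inserts_iff)
      moreover have "set w' = insert (- ?m) (set w)" using w'(2) by (auto simp: mem_inserts_iff)
      ultimately show False using v by auto
    qed
    then show ?thesis using v by (simp add: distinct_inserts)
  qed
  have "distinct (concat (map ?f (simsun_words n)))"
  proof (rule distinct_concat[OF d1])
    show "distinct ys" if "ys \<in> set (map ?f (simsun_words n))" for ys
      using that d2 by auto
    show "set ys \<inter> set zs = {}"
      if "ys \<in> set (map ?f (simsun_words n))" "zs \<in> set (map ?f (simsun_words n))" "ys \<noteq> zs" for ys zs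
    proof -
      from that obtain w w2 where "w \<in> set (simsun_words n)" "w2 \<in> set (simsun_words n)"
        "ys = ?f w" "zs = ?f w2" by auto
      then show ?thesis using disj that(3) by metis
    qed
  qed
  then show ?case by simp
qed simp

section \<open>Signed descent sums over simsun words\<close>

definition neg :: "int list \<Rightarrow> nat" where
  "neg w = length (filter (\<lambda>v. v < 0) w)"

definition signed_sum :: "'a::comm_ring_1 \<Rightarrow> nat \<Rightarrow> 'a" where
  "signed_sum x n = (\<Sum>w\<leftarrow>simsun_words n. (- 1) ^ neg w * x ^ des w)"

definition signed_sum_asc :: "'a::comm_ring_1 \<Rightarrow> nat \<Rightarrow> 'a" where
  "signed_sum_asc x n =
     (\<Sum>w\<leftarrow>simsun_words n. if first_descent w then 0 else (- 1) ^ neg w * x ^ des w)"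

lemma neg_inserts: "w' \<in> set (inserts v w) \<Longrightarrow> neg w' = neg w + (if v < 0 then 1 else 0)"
  by (auto simp: mem_inserts_iff neg_def)

lemma sum_list_concat_map:
  "(\<Sum>y\<leftarrow>concat (map f xs). g y) = (\<Sum>x\<leftarrow>xs. \<Sum>y\<leftarrow>f x. g y)"
  by (induction xs) auto

lemma sum_list_simsun_words_Suc:
  fixes g :: "int list \<Rightarrow> 'a::comm_ring_1"
  shows "(\<Sum>w\<leftarrow>simsun_words (Suc n). (- 1) ^ neg w * g w) =
    (\<Sum>w\<leftarrow>simsun_words n. (- 1) ^ neg w *
       ((\<Sum>w'\<leftarrow>inserts (int n + 1) w. if no_dd w' then g w' else 0)
      - (\<Sum>w'\<leftarrow>inserts (- (int n + 1)) w. if no_dd w' then g w' else 0)))"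
proof -
  let ?h = "\<lambda>w'. if no_dd w' then (- 1) ^ neg w' * g w' else 0"
  have ins: "(\<Sum>w'\<leftarrow>inserts v w. ?h w') =
      (- 1) ^ (neg w + (if v < 0 then 1 else 0)) * (\<Sum>w'\<leftarrow>inserts v w. if no_dd w' then g w' else 0)"
    for v w
    unfolding sum_list_const_mult[symmetric]
    by (intro arg_cong[where f = sum_list] map_cong refl) (auto simp: neg_inserts)
  have "(\<Sum>w\<leftarrow>simsun_words (Suc n). (- 1) ^ neg w * g w) =
      (\<Sum>w'\<leftarrow>concat (map (\<lambda>w. inserts (int n + 1) w @ inserts (- (int n + 1)) w) (simsun_words n)).
        ?h w')"
    by (simp add: sum_list_map_filter')
  also have "\<dots> = (\<Sum>w\<leftarrow>simsun_words n.
      (\<Sum>w'\<leftarrow>inserts (int n + 1) w. ?h w') + (\<Sum>w'\<leftarrow>inserts (- (int n + 1)) w. ?h w'))"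
    by (simp only: sum_list_concat_map map_append sum_list_append)
  also have "\<dots> = (\<Sum>w\<leftarrow>simsun_words n. (- 1) ^ neg w *
       ((\<Sum>w'\<leftarrow>inserts (int n + 1) w. if no_dd w' then g w' else 0)
      - (\<Sum>w'\<leftarrow>inserts (- (int n + 1)) w. if no_dd w' then g w' else 0)))"
    unfolding ins by (simp add: algebra_simps)
  finally show ?thesis .
qed

lemma simsun_words_insertable:
  assumes "w \<in> set (simsun_words n)"
  shows "w \<noteq> []" "no_dd w" "distinct w" "\<forall>a\<in>set w. \<bar>a\<bar> < int n + 1"
  using simsun_words_no_dd[OF assms] simsun_words_signed[OF assms]
  by (auto dest: signed_words_nonempty distinct_signed_words signed_words_bound)

lemma signed_sum_asc_Suc: "signed_sum_asc x (Suc n) = signed_sum x n"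
proof -
  have "signed_sum_asc x (Suc n) =
      (\<Sum>w\<leftarrow>simsun_words (Suc n). (- 1) ^ neg w * (if first_descent w then 0 else x ^ des w))"
    unfolding signed_sum_asc_def
    by (intro arg_cong[where f = sum_list] map_cong refl) auto
  also have "\<dots> = (\<Sum>w\<leftarrow>simsun_words n. (- 1) ^ neg w *
      (insertion_sum_asc x (int n + 1) w - insertion_sum_asc x (- (int n + 1)) w))"
    unfolding sum_list_simsun_words_Suc insertion_sum_asc_def
    by (intro arg_cong[where f = sum_list] map_cong arg_cong2[where f = "(*)"]
        arg_cong2[where f = "(-)"] refl) auto
  also have "\<dots> = signed_sum x n"
    unfolding signed_sum_def
    by (intro arg_cong[where f = sum_list] map_cong refl)
      (simp only: signed_insertions_ascent[OF simsun_words_insertable])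
  finally show ?thesis .
qed

lemma signed_sum_Suc: "signed_sum x (Suc n) = signed_sum x n - x * signed_sum_asc x n"
proof -
  have "signed_sum x (Suc n) = (\<Sum>w\<leftarrow>simsun_words n. (- 1) ^ neg w *
      (insertion_sum x (int n + 1) w - insertion_sum x (- (int n + 1)) w))"
    unfolding signed_sum_def sum_list_simsun_words_Suc insertion_sum_def ..
  also have "\<dots> = (\<Sum>w\<leftarrow>simsun_words n. (- 1) ^ neg w * x ^ des w
      - x * (if first_descent w then 0 else (- 1) ^ neg w * x ^ des w))"
    by (intro arg_cong[where f = sum_list] map_cong refl)
      (simp only: signed_insertions[OF simsun_words_insertable], simp add: algebra_simps)
  also have "\<dots> = signed_sum x n - x * signed_sum_asc x n"
    unfolding signed_sum_def signed_sum_asc_def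
    by (simp only: sum_list_subtractf sum_list_const_mult)
  finally show ?thesis .
qed

lemma signed_sum_asc_0: "signed_sum_asc x 0 = 1"
  by (simp add: signed_sum_asc_def neg_def)

lemma signed_sum_0: "signed_sum x 0 = 1"
  by (simp add: signed_sum_def neg_def)

text \<open>
  Substituting \<open>1 / (2 s)\<close> turns the factor \<open>2 x\<close> of the Chebyshev recurrence into \<open>1 / s\<close>;
  scaling by \<open>s\<^sup>n\<close> then gives the recurrence of \<open>signed_sum_asc\<close>.
\<close>

lemma signed_sum_asc_Chebyshev:
  fixes s :: real
  assumes "s \<noteq> 0"
  shows "signed_sum_asc (s\<^sup>2) n = s ^ n * poly (Chebyshev_U n) (1 / (2 * s))"
proof (induction n rule: Chebyshev_U.induct)
  case 1 then show ?case by (simp add: signed_sum_asc_0)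
next
  case 2 then show ?case using assms by (simp add: signed_sum_asc_Suc signed_sum_0)
next
  case (3 m)
  have "signed_sum_asc (s\<^sup>2) (Suc (Suc m)) =
      signed_sum_asc (s\<^sup>2) (Suc m) - s\<^sup>2 * signed_sum_asc (s\<^sup>2) m"
    by (simp only: signed_sum_asc_Suc signed_sum_Suc)
  also have "\<dots> = s ^ Suc (Suc m) * poly (Chebyshev_U (Suc (Suc m))) (1 / (2 * s))"
    unfolding 3 using assms by (simp add: field_simps power2_eq_square)
  finally show ?case .
qed

section \<open>Signed permutations as words\<close>

lemma signed_perms_0: "\<pi> \<in> signed_perms n \<Longrightarrow> \<pi> 0 = 0"
  by (auto simp: signed_perms_def permutes_def)

lemma length_sp_word [simp]: "length (sp_word n \<pi>) = Suc n"
  by (simp add: sp_word_def)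

lemma nth_sp_word: "i \<le> n \<Longrightarrow> sp_word n \<pi> ! i = \<pi> (int i)"
  by (simp add: sp_word_def nth_upto)

lemma set_sp_word: "set (sp_word n \<pi>) = \<pi> ` {0..int n}"
  by (simp add: sp_word_def)

lemma sp_word_mem_signed_words:
  assumes \<pi>: "\<pi> \<in> signed_perms n"
  shows "sp_word n \<pi> \<in> signed_words n"
proof -
  have perm: "\<pi> permutes ({- int n..int n} - {0})" and odd: "\<And>i. \<pi> (- i) = - \<pi> i"
    using \<pi> by (auto simp: signed_perms_def)
  have inj: "\<pi> i = \<pi> j \<Longrightarrow> i = j" for i j
    using permutes_inj[OF perm] by (auto dest: injD)
  have "inj_on (\<lambda>i. \<bar>\<pi> i\<bar>) {0..int n}"
  proof (rule inj_onI)
    fix i j assume h: "i \<in> {0..int n}" "j \<in> {0..int n}" "\<bar>\<pi> i\<bar> = \<bar>\<pi> j\<bar>"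
    then have "\<pi> i = \<pi> j \<or> \<pi> i = \<pi> (- j)" by (auto simp: odd abs_eq_iff)
    then show "i = j" using h(1,2) inj by force
  qed
  then have d: "distinct (map abs (sp_word n \<pi>))"
    by (simp add: sp_word_def distinct_map o_def comp_inj_on_iff inj_on_def)
  have "\<pi> i \<in> {- int n..int n}" if "i \<in> {0..int n}" for i
    using that permutes_in_image[OF perm, of i] signed_perms_0[OF \<pi>] by (cases "i = 0") auto
  then have "abs ` set (sp_word n \<pi>) \<subseteq> {0..int n}"
    by (fastforce simp: set_sp_word)
  moreover have "card (abs ` set (sp_word n \<pi>)) = card {0..int n}"
    using distinct_card[OF d] by simp
  ultimately have "abs ` set (sp_word n \<pi>) = {0..int n}"
    by (intro card_subset_eq) auto
  moreover have "hd (sp_word n \<pi>) = 0"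
    using signed_perms_0[OF \<pi>] nth_sp_word[of 0 n \<pi>] by (subst hd_conv_nth) (auto simp flip: length_0_conv)
  ultimately show ?thesis using d by (simp add: signed_words_def)
qed

lemma signed_words_sp_word:
  assumes w: "w \<in> signed_words n"
  obtains \<pi> where "\<pi> \<in> signed_perms n" "sp_word n \<pi> = w"
proof -
  let ?S = "{- int n..int n} - {0}"
  \<comment> \<open>The odd extension of the word; \<open>sgn 0 = 0\<close> agrees with the leading letter \<open>0\<close>.\<close>
  define \<pi> where "\<pi> i = (if \<bar>i\<bar> \<le> int n then sgn i * w ! nat \<bar>i\<bar> else i)" for i
  have len: "length w = Suc n" using length_signed_words[OF w] .
  have w0: "w ! 0 = 0" using w len by (cases w) (auto simp: signed_words_def)
  have absinj: "k = l" if "\<bar>w ! k\<bar> = \<bar>w ! l\<bar>" "k \<le> n" "l \<le> n" for k l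
    using w that len nth_eq_iff_index_eq[of "map abs w" k l] by (auto simp: signed_words_def)
  have nz: "w ! k \<noteq> 0" if "0 < k" "k \<le> n" for k
    using absinj[of k 0] w0 that by auto
  have bd: "\<bar>w ! k\<bar> \<le> int n" if "k \<le> n" for k
    using signed_words_bound[OF w, of "w ! k"] that len by (simp add: nth_mem)
  have "\<pi> ` ?S \<subseteq> ?S"
  proof
    fix y assume "y \<in> \<pi> ` ?S"
    then obtain i where i: "i \<in> ?S" "y = \<pi> i" by (elim imageE)
    then have "nat \<bar>i\<bar> \<le> n" "0 < nat \<bar>i\<bar>" by auto
    then show "y \<in> ?S"
      using i nz[of "nat \<bar>i\<bar>"] bd[of "nat \<bar>i\<bar>"] by (auto simp: \<pi>_def sgn_if abs_le_iff)
  qed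
  moreover have inj: "inj_on \<pi> ?S"
  proof (rule inj_onI)
    fix i j assume h: "i \<in> ?S" "j \<in> ?S" "\<pi> i = \<pi> j"
    then have eq: "sgn i * w ! nat \<bar>i\<bar> = sgn j * w ! nat \<bar>j\<bar>"
      by (auto simp: \<pi>_def abs_le_iff)
    have ran: "nat \<bar>i\<bar> \<le> n" "nat \<bar>j\<bar> \<le> n" "0 < nat \<bar>j\<bar>" "\<bar>sgn i\<bar> = 1" "\<bar>sgn j\<bar> = 1"
      using h(1,2) by (auto simp: abs_sgn_eq)
    have "\<bar>w ! nat \<bar>i\<bar>\<bar> = \<bar>w ! nat \<bar>j\<bar>\<bar>"
      using arg_cong[OF eq, of abs] ran by (simp add: abs_mult)
    then have ij: "nat \<bar>i\<bar> = nat \<bar>j\<bar>" using absinj ran by blast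
    then have "sgn i = sgn j" using eq nz[OF ran(3,2)] by simp
    moreover have "\<bar>i\<bar> = \<bar>j\<bar>" using ij by simp
    ultimately show "i = j" by (metis sgn_mult_abs)
  qed
  ultimately have "bij_betw \<pi> ?S ?S"
    unfolding bij_betw_def by (simp add: endo_inj_surj)
  then have "\<pi> permutes ?S"
    by (rule bij_imp_permutes) (auto simp: \<pi>_def)
  moreover have "\<pi> (- i) = - \<pi> i" for i by (simp add: \<pi>_def sgn_minus)
  ultimately have "\<pi> \<in> signed_perms n" by (simp add: signed_perms_def)
  moreover have "sp_word n \<pi> = w"
  proof (rule nth_equalityI)
    fix i assume "i < length (sp_word n \<pi>)"
    then have "i \<le> n" by simp
    then show "sp_word n \<pi> ! i = w ! i"
      using w0 by (cases "i = 0") (auto simp: nth_sp_word \<pi>_def)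
  qed (simp add: len)
  ultimately show thesis using that by blast
qed

lemma inj_on_sp_word: "inj_on (sp_word n) (signed_perms n)"
proof (rule inj_onI, rule ext)
  fix \<pi> \<sigma> i assume h: "\<pi> \<in> signed_perms n" "\<sigma> \<in> signed_perms n" "sp_word n \<pi> = sp_word n \<sigma>"
  then have odd: "\<pi> (- i) = - \<pi> i" "\<sigma> (- i) = - \<sigma> i" for i by (auto simp: signed_perms_def)
  have pos: "\<pi> i = \<sigma> i" if "i \<in> {0..int n}" for i
    using h(3) that by (auto simp: sp_word_def)
  have fix_out: "\<pi> i = i" "\<sigma> i = i" if "\<bar>i\<bar> > int n" for i
    using h(1,2) that by (auto simp: signed_perms_def elim!: permutes_not_in)
  consider "i \<in> {0..int n}" | "- i \<in> {0..int n}" | "\<bar>i\<bar> > int n" by force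
  then show "\<pi> i = \<sigma> i"
    using pos[of i] pos[of "- i"] odd[of i] fix_out by cases auto
qed

lemma no_dd_conv_nth:
  "no_dd w \<longleftrightarrow> (\<forall>i. Suc (Suc i) < length w \<longrightarrow> \<not> (w ! Suc i < w ! i \<and> w ! Suc (Suc i) < w ! Suc i))"
proof (induction w rule: no_dd.induct)
  case (1 a b c u)
  have all_nat: "(\<forall>i. P i) \<longleftrightarrow> P 0 \<and> (\<forall>i. P (Suc i))" for P :: "nat \<Rightarrow> bool"
    by (metis not0_implies_Suc)
  show ?case by (subst all_nat) (use 1 in auto)
qed auto

lemma no_dd_sp_word: "no_dd (sp_word n \<pi>) \<longleftrightarrow> (\<forall>i. \<not> double_descent n \<pi> i)"
proof
  assume nd: "no_dd (sp_word n \<pi>)"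
  show "\<forall>i. \<not> double_descent n \<pi> i"
  proof (intro allI notI)
    fix i assume dd: "double_descent n \<pi> i"
    define k where "k = nat (i - 1)"
    have "i = int k + 1" "Suc (Suc k) \<le> n" using dd by (auto simp: k_def double_descent_def)
    then show False
      using nd dd unfolding no_dd_conv_nth
      by (auto simp: nth_sp_word double_descent_def dest!: spec[of _ k] simp: add.commute)
  qed
next
  assume nd: "\<forall>i. \<not> double_descent n \<pi> i"
  show "no_dd (sp_word n \<pi>)"
    unfolding no_dd_conv_nth
  proof (intro allI impI)
    fix k assume "Suc (Suc k) < length (sp_word n \<pi>)"
    then show "\<not> (sp_word n \<pi> ! Suc k < sp_word n \<pi> ! k \<and> sp_word n \<pi> ! Suc (Suc k) < sp_word n \<pi> ! Suc k)"
      using nd[rule_format, of "int k + 1"] by (auto simp: nth_sp_word double_descent_def add.commute)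
  qed
qed

lemma des_conv_nth: "des w = card {i. Suc i < length w \<and> w ! Suc i < w ! i}"
proof (induction w rule: des.induct)
  case (1 a b u)
  let ?D = "\<lambda>w. {i. Suc i < length w \<and> w ! Suc i < (w ! i :: int)}"
  have "?D (a # b # u) = (if b < a then {0} else {}) \<union> Suc ` ?D (b # u)"
    by (auto simp: image_iff less_Suc_eq_0_disj split: if_splits)
  moreover have "finite (?D (b # u))" by (rule finite_subset[of _ "{..<length (b # u)}"]) auto
  ultimately have "card (?D (a # b # u)) = (if b < a then 1 else 0) + card (?D (b # u))"
    by (auto simp: card_image card_insert_if)
  then show ?case using 1 by simp
qed auto

lemma des_sp_word: "des (sp_word n \<pi>) = des_B n \<pi>"
proof -
  have "{i \<in> {0..int n - 1}. \<pi> i > \<pi> (i + 1)} =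
      int ` {i. Suc i < length (sp_word n \<pi>) \<and> sp_word n \<pi> ! Suc i < sp_word n \<pi> ! i}"
  proof (intro set_eqI iffI)
    fix i assume "i \<in> {i \<in> {0..int n - 1}. \<pi> i > \<pi> (i + 1)}"
    then show "i \<in> int ` {i. Suc i < length (sp_word n \<pi>) \<and> sp_word n \<pi> ! Suc i < sp_word n \<pi> ! i}"
      by (intro image_eqI[of _ _ "nat i"]) (auto simp: nth_sp_word add.commute)
  qed (auto simp: nth_sp_word add.commute)
  then show ?thesis by (simp add: des_conv_nth des_B_def card_image)
qed

lemma neg_sp_word:
  assumes "\<pi> \<in> signed_perms n"
  shows "neg (sp_word n \<pi>) = neg_count n \<pi>"
proof -
  have "distinct (sp_word n \<pi>)"
    using distinct_signed_words sp_word_mem_signed_words[OF assms] by blast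
  then have "neg (sp_word n \<pi>) = card {v \<in> \<pi> ` {0..int n}. v < 0}"
    unfolding neg_def using distinct_card[of "filter (\<lambda>v. v < 0) (sp_word n \<pi>)"]
    by (simp add: set_sp_word)
  also have "{v \<in> \<pi> ` {0..int n}. v < 0} = {v \<in> \<pi> ` {1..int n}. v < 0}"
  proof -
    have "{0..int n} = insert 0 {1..int n}" by auto
    then show ?thesis using signed_perms_0[OF assms] by auto
  qed
  finally show ?thesis by (simp add: neg_count_def)
qed

lemma first_descent_sp_word:
  assumes "\<pi> \<in> signed_perms n" "n > 0"
  shows "first_descent (sp_word n \<pi>) \<longleftrightarrow> \<pi> 1 < 0" and "\<pi> 1 \<noteq> 0"
proof -
  obtain u where "sp_word n \<pi> = 0 # \<pi> 1 # u"
    using signed_perms_0[OF assms(1)] assms(2) by (simp add: sp_word_def upto_rec1)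
  then show "first_descent (sp_word n \<pi>) \<longleftrightarrow> \<pi> 1 < 0" by simp
  have "inj \<pi>" using assms(1) permutes_inj by (auto simp: signed_perms_def)
  then show "\<pi> 1 \<noteq> 0" using signed_perms_0[OF assms(1)] by (metis injD zero_neq_one)
qed

text \<open>
  Every word left after deleting the largest letters is the word of some signed permutation, so
  only the absence of double descents is a real condition.
\<close>

lemma signed_simsun_iff:
  "signed_simsun n \<pi> \<longleftrightarrow> \<pi> \<in> signed_perms n \<and> sp_word n \<pi> \<in> set (simsun_words n)"
proof (cases "\<pi> \<in> signed_perms n")
  case True
  let ?w = "sp_word n \<pi>"
  have w: "?w \<in> signed_words n" by (rule sp_word_mem_signed_words[OF True])
  have rem: "remove_largest n k ?w = filter (\<lambda>v. \<bar>v\<bar> \<le> int (n - k)) ?w" if "k \<le> n" for k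
    unfolding remove_largest_def using signed_words_bound[OF w] that
    by (intro filter_cong refl) force
  have step: "(\<exists>\<sigma>\<in>signed_perms (n - k). sp_word (n - k) \<sigma> = remove_largest n k ?w \<and>
        (\<forall>i. \<not> double_descent (n - k) \<sigma> i)) \<longleftrightarrow> no_dd (filter (\<lambda>v. \<bar>v\<bar> \<le> int (n - k)) ?w)"
    if "k \<le> n" for k
  proof -
    obtain \<sigma> where "\<sigma> \<in> signed_perms (n - k)"
      "sp_word (n - k) \<sigma> = filter (\<lambda>v. \<bar>v\<bar> \<le> int (n - k)) ?w"
      using signed_words_sp_word[OF filter_mem_signed_words[OF w, of "n - k"]] by auto
    then show ?thesis unfolding rem[OF that] no_dd_sp_word[symmetric] by metis
  qed
  have "(\<forall>k\<le>n. no_dd (filter (\<lambda>v. \<bar>v\<bar> \<le> int (n - k)) ?w)) \<longleftrightarrow>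
      (\<forall>j\<le>n. no_dd (filter (\<lambda>v. \<bar>v\<bar> \<le> int j) ?w))"
    by (metis diff_diff_cancel diff_le_self)
  moreover have "signed_simsun n \<pi> \<longleftrightarrow> (\<forall>k\<le>n. no_dd (filter (\<lambda>v. \<bar>v\<bar> \<le> int (n - k)) ?w))"
    unfolding signed_simsun_def using True step by blast
  ultimately show ?thesis
    using True w by (simp only: set_simsun_words mem_Collect_eq simp_thms)
qed (simp add: signed_simsun_def)

lemma bij_betw_RB_simsun_words: "bij_betw (sp_word n) (RB n) (set (simsun_words n))"
  unfolding bij_betw_def
proof
  show "inj_on (sp_word n) (RB n)"
    using inj_on_sp_word by (rule inj_on_subset) (auto simp: RB_def signed_simsun_iff)
  show "sp_word n ` RB n = set (simsun_words n)"
  proof (intro equalityI subsetI)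
    fix w assume w: "w \<in> set (simsun_words n)"
    obtain \<pi> where "\<pi> \<in> signed_perms n" "sp_word n \<pi> = w"
      using signed_words_sp_word[OF simsun_words_signed[OF w]] .
    then show "w \<in> sp_word n ` RB n"
      using w by (intro image_eqI[of _ _ \<pi>]) (simp_all add: RB_def signed_simsun_iff)
  qed (auto simp: RB_def signed_simsun_iff)
qed

lemma finite_RB: "finite (RB n)"
  using bij_betw_finite[OF bij_betw_RB_simsun_words] by auto

section \<open>The signed descent polynomials\<close>

lemma des_poly_even_minus_odd:
  assumes "finite A"
  shows "des_poly n {\<pi> \<in> A. even (neg_count n \<pi>)} - des_poly n {\<pi> \<in> A. odd (neg_count n \<pi>)}
    = (\<Sum>\<pi>\<in>A. (- 1) ^ neg_count n \<pi> * monom 1 1 ^ des_B n \<pi>)"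
proof -
  let ?f = "\<lambda>\<pi>. (- 1) ^ neg_count n \<pi> * (monom 1 1 :: real poly) ^ des_B n \<pi>"
  have "sum ?f A = sum ?f {\<pi> \<in> A. even (neg_count n \<pi>)} + sum ?f {\<pi> \<in> A. odd (neg_count n \<pi>)}"
    using assms by (subst sum.union_disjoint[symmetric]) (auto intro!: sum.cong)
  then show ?thesis
    by (simp add: des_poly_def monom_power sum_negf)
qed

text \<open>
  At \<open>n = 0\<close> the conventional values agree with the sums over the single word consisting of \<open>0\<close>,
  both here and for words that do not start with a descent.
\<close>

lemma D_minus_T: "D_poly n - T_poly n = signed_sum (monom 1 1) n"
proof -
  have "des_poly n (RD n) - des_poly n (RT n) =
      (\<Sum>\<pi>\<in>RB n. (- 1) ^ neg (sp_word n \<pi>) * monom 1 1 ^ des (sp_word n \<pi>))"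
    unfolding RD_def RT_def des_poly_even_minus_odd[OF finite_RB]
    by (intro sum.cong refl) (simp add: des_sp_word neg_sp_word RB_def signed_simsun_def)
  also have "\<dots> = (\<Sum>w\<in>set (simsun_words n). (- 1) ^ neg w * monom 1 1 ^ des w)"
    by (rule sum.reindex_bij_betw[OF bij_betw_RB_simsun_words])
  also have "\<dots> = signed_sum (monom 1 1) n"
    unfolding signed_sum_def by (simp add: sum.distinct_set_conv_list distinct_simsun_words)
  finally show ?thesis by (auto simp: D_poly_def T_poly_def signed_sum_0)
qed

lemma D_plus_minus_T_plus:
  "D_plus_poly n - T_plus_poly n = signed_sum_asc (monom 1 1) n"
proof (cases "n = 0")
  case False
  have eq: "RD_plus n = {\<pi> \<in> {\<pi> \<in> RB n. \<pi> 1 > 0}. even (neg_count n \<pi>)}"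
    "RT_plus n = {\<pi> \<in> {\<pi> \<in> RB n. \<pi> 1 > 0}. odd (neg_count n \<pi>)}"
    by (auto simp: RD_plus_def RT_plus_def RD_def RT_def)
  have fin: "finite {\<pi> \<in> RB n. \<pi> 1 > 0}" using finite_RB by simp
  have "des_poly n (RD_plus n) - des_poly n (RT_plus n) =
      (\<Sum>\<pi>\<in>RB n. if 0 < \<pi> 1 then (- 1) ^ neg_count n \<pi> * monom 1 1 ^ des_B n \<pi> else 0)"
    unfolding eq by (subst des_poly_even_minus_odd) (simp_all only: fin finite_RB sum.inter_filter)
  also have "\<dots> = (\<Sum>\<pi>\<in>RB n. if first_descent (sp_word n \<pi>) then 0
      else (- 1) ^ neg (sp_word n \<pi>) * monom 1 1 ^ des (sp_word n \<pi>))"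
    using first_descent_sp_word False
    by (intro sum.cong refl)
      (force simp: des_sp_word neg_sp_word RB_def signed_simsun_def)
  also have "\<dots> = (\<Sum>w\<in>set (simsun_words n). if first_descent w then 0
      else (- 1) ^ neg w * monom 1 1 ^ des w)"
    by (rule sum.reindex_bij_betw[OF bij_betw_RB_simsun_words])
  also have "\<dots> = signed_sum_asc (monom 1 1) n"
    unfolding signed_sum_asc_def by (simp add: sum.distinct_set_conv_list distinct_simsun_words)
  finally show ?thesis using False by (auto simp: D_plus_poly_def T_plus_poly_def)
qed (simp add: D_plus_poly_def T_plus_poly_def signed_sum_asc_0)

lemma des_poly_split_first:
  assumes "n > 0" "A \<subseteq> RB n"
  shows "des_poly n A = des_poly n {\<pi> \<in> A. \<pi> 1 > 0} + des_poly n {\<pi> \<in> A. \<pi> 1 < 0}"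
proof -
  have "A = {\<pi> \<in> A. \<pi> 1 > 0} \<union> {\<pi> \<in> A. \<pi> 1 < 0}"
    using assms first_descent_sp_word(2)[of _ n] by (force simp: RB_def signed_simsun_def)
  then have "des_poly n A = des_poly n ({\<pi> \<in> A. \<pi> 1 > 0} \<union> {\<pi> \<in> A. \<pi> 1 < 0})" by simp
  also have "\<dots> = des_poly n {\<pi> \<in> A. \<pi> 1 > 0} + des_poly n {\<pi> \<in> A. \<pi> 1 < 0}"
    unfolding des_poly_def using finite_subset[OF assms(2) finite_RB]
    by (intro sum.union_disjoint) auto
  finally show ?thesis .
qed

lemma T_minus_minus_D_minus:
  assumes "n > 0"
  shows "T_minus_poly n - D_minus_poly n = signed_sum_asc (monom 1 1) n - signed_sum (monom 1 1) n"
proof -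
  have "RD n \<subseteq> RB n" "RT n \<subseteq> RB n" by (auto simp: RD_def RT_def)
  from this[THEN des_poly_split_first[OF assms]]
  have "D_poly n = D_plus_poly n + D_minus_poly n" "T_poly n = T_plus_poly n + T_minus_poly n"
    using assms by (simp_all add: D_poly_def T_poly_def D_plus_poly_def D_minus_poly_def
        T_plus_poly_def T_minus_poly_def RD_plus_def RD_minus_def RT_plus_def RT_minus_def)
  then show ?thesis
    unfolding D_minus_T[symmetric] D_plus_minus_T_plus[symmetric] by simp
qed

text \<open>
  Both sums have to be carried through the induction, as their recurrences are coupled.
\<close>

lemma poly_signed_sum_asc: "poly (signed_sum_asc p n) x = signed_sum_asc (poly p x) n"
proof -
  have "poly (signed_sum_asc p n) x = signed_sum_asc (poly p x) n \<and>
      poly (signed_sum p n) x = signed_sum (poly p x) n"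
    by (induction n) (simp_all add: signed_sum_asc_0 signed_sum_0 signed_sum_asc_Suc signed_sum_Suc)
  then show ?thesis ..
qed

theorem theorem8:
  fixes n :: nat
  shows "D_poly n - T_poly n = D_plus_poly (n + 1) - T_plus_poly (n + 1) \<and>
    (\<forall>x::real. x \<noteq> 0 \<longrightarrow>
       poly (D_plus_poly (n + 1) - T_plus_poly (n + 1)) x
         = (1 / x) * poly (T_minus_poly (n + 2) - D_minus_poly (n + 2)) x) \<and>
    (\<forall>x::real. x > 0 \<longrightarrow>
       (1 / x) * poly (T_minus_poly (n + 2) - D_minus_poly (n + 2)) x
         = x powr ((real n + 1) / 2) * poly (Chebyshev_U (n + 1)) (1 / (2 * sqrt x)))"
proof -
  let ?P = "signed_sum_asc (monom 1 1 :: real poly)"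
  have minus: "T_minus_poly (n + 2) - D_minus_poly (n + 2) = monom 1 1 * ?P (n + 1)"
    by (simp add: T_minus_minus_D_minus signed_sum_asc_Suc signed_sum_Suc)
  have "(1 / x) * poly (T_minus_poly (n + 2) - D_minus_poly (n + 2)) x = poly (?P (n + 1)) x"
    if "x \<noteq> 0" for x :: real
    unfolding minus using that by (simp add: poly_monom)
  moreover have "poly (?P (n + 1)) x =
      x powr ((real n + 1) / 2) * poly (Chebyshev_U (n + 1)) (1 / (2 * sqrt x))"
    if "x > 0" for x :: real
  proof -
    have "sqrt x ^ (n + 1) = x powr ((real n + 1) / 2)"
    proof -
      have "sqrt x ^ (n + 1) = (x powr (1 / 2)) powr real (n + 1)"
        using that by (subst powr_realpow) (simp_all add: powr_half_sqrt)
      then show ?thesis by (simp add: powr_powr add.commute)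
    qed
    moreover have "poly (?P (n + 1)) x = signed_sum_asc ((sqrt x)\<^sup>2) (n + 1)"
      using that by (simp only: poly_signed_sum_asc poly_monom) simp
    ultimately show ?thesis
      using signed_sum_asc_Chebyshev[of "sqrt x" "n + 1"] that by simp
  qed
  moreover have "D_poly n - T_poly n = D_plus_poly (n + 1) - T_plus_poly (n + 1)"
    by (simp only: D_minus_T D_plus_minus_T_plus Suc_eq_plus1[symmetric] signed_sum_asc_Suc)
  ultimately show ?thesis by (simp add: D_plus_minus_T_plus)
qed

end
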